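(* Let $q=q(n)\in[0,1]$ satisfy $q(n)\geq 1-\frac{1}{50n}$ for every integer $n\ge 1$. Then with high probability the tangled path $\mathcal{P}(n,q)$ is a vertex-expander; that is, there exists a constant $c>0$, independent of $n$, such that with probability tending to $1$ as $n\to\infty$, every non-empty set $S\subseteq [n]$ with $|S|\leq \lceil n/2\rceil$ is adjacent in $\mathcal{P}(n,q)$ to at least $c|S|$ vertices of $[n]\setminus S$.
   Context: Let $[n]=\{1,\dots,n\}$ and let $S_n$ be the set of permutations of $[n]$. For $\sigma\in S_n$, $\mathrm{Inv}(\sigma)=|\{(i,j): i<j,\ \sigma(i)>\sigma(j)\}|$. For $0<q\le 1$ the $(n,q)$-Mallows measure on $S_n$ is $\mu_{n,q}(\sigma)=q^{\mathrm{Inv}(\sigma)}/Z_{n,q}$, where $Z_{n,q}=\prod_{i=1}^n(1+q+\cdots+q^{i-1})$ (so $\mu_{n,1}$ is uniform), and $\mu_{n,0}$ is the point mass at the identity. The tangled path $\mathcal{P}(n,q)$ is the random graph with vertex set $[n]$ and edge set $\{i(i+1):1\le i<n\}\cup\{\sigma(i)\sigma(i+1):1\le i<n\}$, where $\sigma\sim\mu_{n,q}$ (multi-edges are identified to a single edge). A sequence of events $\mathcal{E}_n$ holds with high probability if $\mathbb{P}(\mathcal{E}_n)\to1$ as $n\to\infty$. *)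

theory Defs
  imports "HOL-Probability.Probability" "HOL-Combinatorics.Combinatorics"
begin

definition inversions :: "nat \<Rightarrow> (nat \<Rightarrow> nat) \<Rightarrow> nat" where
  "inversions n \<sigma> = card {(i, j). i \<in> {1..n} \<and> j \<in> {1..n} \<and> i < j \<and> \<sigma> i > \<sigma> j}"

definition mallows_Z :: "nat \<Rightarrow> real \<Rightarrow> real" where
  "mallows_Z n q = (\<Prod>i=1..n. \<Sum>j<i. q ^ j)"

text \<open>
  Elements of the symmetric group are functions fixing every point outside \<open>{1..n}\<close>
  (the predicate \<open>permutes\<close>). Since \<open>0 ^ 0 = 1\<close>, the formula also covers \<open>q = 0\<close>,
  where it gives the point mass at the identity; see \<open>mallows_0\<close>.
  The lemma \<open>pmf_mallows\<close> shows that it is a probability mass function for \<open>q \<ge> 0\<close>.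
\<close>

definition mallows :: "nat \<Rightarrow> real \<Rightarrow> (nat \<Rightarrow> nat) pmf" where
  "mallows n q =
     embed_pmf (\<lambda>\<sigma>. if \<sigma> permutes {1..n} then q ^ inversions n \<sigma> / mallows_Z n q else 0)"

definition tangled_edges :: "nat \<Rightarrow> (nat \<Rightarrow> nat) \<Rightarrow> nat set set" where
  "tangled_edges n \<sigma> =
     {{i, i + 1} | i. 1 \<le> i \<and> i < n} \<union> {{\<sigma> i, \<sigma> (i + 1)} | i. 1 \<le> i \<and> i < n}"

text \<open>The random edge set; the vertex set is always \<open>{1..n}\<close>.\<close>

definition tangled_path :: "nat \<Rightarrow> real \<Rightarrow> nat set set pmf" where
  "tangled_path n q = map_pmf (tangled_edges n) (mallows n q)"

definition vertex_boundary :: "'a set \<Rightarrow> 'a set set \<Rightarrow> 'a set \<Rightarrow> 'a set" where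
  "vertex_boundary V E S = {v \<in> V - S. \<exists>u\<in>S. {u, v} \<in> E}"

definition vertex_expander :: "real \<Rightarrow> 'a set \<Rightarrow> 'a set set \<Rightarrow> bool" where
  "vertex_expander c V E \<longleftrightarrow>
     (\<forall>S. S \<subseteq> V \<and> S \<noteq> {} \<and> int (card S) \<le> \<lceil>real (card V) / 2\<rceil> \<longrightarrow>
        real (card (vertex_boundary V E S)) \<ge> c * real (card S))"

text \<open>
  The normalisation: every permutation of \<open>{1..n+1}\<close> arises uniquely from one of \<open>{1..n}\<close>
  by choosing the image \<open>k\<close> of \<open>n + 1\<close> and shifting the values \<open>\<ge> k\<close> up by one.
\<close>

definition insert_value :: "nat \<Rightarrow> nat \<Rightarrow> nat \<Rightarrow> nat" where
  "insert_value n k x = (if x = Suc n then k else if k \<le> x \<and> x \<le> n then Suc x else x)"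

lemma insert_value_permutes:
  assumes "k \<in> {1..Suc n}"
  shows "insert_value n k permutes {1..Suc n}"
proof (rule bij_imp_permutes)
  have inj: "inj_on (insert_value n k) {1..Suc n}"
    using assms by (auto simp: inj_on_def insert_value_def split: if_splits)
  moreover have "insert_value n k ` {1..Suc n} \<subseteq> {1..Suc n}"
    using assms by (auto simp: insert_value_def)
  ultimately show "bij_betw (insert_value n k) {1..Suc n} {1..Suc n}"
    by (metis bij_betw_def endo_inj_surj finite_atLeastAtMost)
  show "insert_value n k x = x" if "x \<notin> {1..Suc n}" for x
    using that assms by (auto simp: insert_value_def)
qed

lemma permutes_Suc_image:
  "{\<sigma>. \<sigma> permutes {1..Suc n}} =
     (\<lambda>(k, \<tau>). insert_value n k \<circ> \<tau>) ` ({1..Suc n} \<times> {\<tau>. \<tau> permutes {1..n}})"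
  and permutes_Suc_inj:
  "inj_on (\<lambda>(k, \<tau>). insert_value n k \<circ> \<tau>) ({1..Suc n} \<times> {\<tau>. \<tau> permutes {1..n}})"
proof -
  let ?f = "\<lambda>(k, \<tau>). insert_value n k \<circ> \<tau>"
  let ?D = "{1..Suc n} \<times> {\<tau>. \<tau> permutes {1..n}}"
  show inj: "inj_on ?f ?D"
  proof (rule inj_onI, clarify)
    fix k \<tau> l \<rho>
    assume k: "k \<in> {1..Suc n}" and l: "l \<in> {1..Suc n}"
      and t: "\<tau> permutes {1..n}" and r: "\<rho> permutes {1..n}"
      and eq: "insert_value n k \<circ> \<tau> = insert_value n l \<circ> \<rho>"
    have "\<tau> (Suc n) = Suc n" "\<rho> (Suc n) = Suc n"
      using t r by (auto intro: permutes_not_in)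
    with fun_cong[OF eq, of "Suc n"] have kl: "k = l"
      by (simp add: insert_value_def)
    have "inj (insert_value n k)"
      using insert_value_permutes[OF k] by (rule permutes_inj)
    with eq kl have "\<tau> = \<rho>"
      by (auto simp: fun_eq_iff dest: injD)
    with kl show "k = l \<and> \<tau> = \<rho>" by simp
  qed
  have sub: "?f ` ?D \<subseteq> {\<sigma>. \<sigma> permutes {1..Suc n}}"
  proof clarify
    fix k \<tau> assume "k \<in> {1..Suc n}" "\<tau> permutes {1..n}"
    then show "insert_value n k \<circ> \<tau> permutes {1..Suc n}"
      by (intro permutes_compose[OF permutes_subset] insert_value_permutes) auto
  qed
  have "card (?f ` ?D) = Suc n * fact n"
    using card_permutations[OF refl, of "{1..n}"] inj
    by (simp add: card_image card_cartesian_product)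
  also have "\<dots> = card {\<sigma>. \<sigma> permutes {1..Suc n}}"
    using card_permutations[OF refl, of "{1..Suc n}"] by simp
  finally show "{\<sigma>. \<sigma> permutes {1..Suc n}} = ?f ` ?D"
    by (metis card_subset_eq finite_atLeastAtMost finite_permutations sub)
qed

lemma inversions_insert_value:
  assumes k: "k \<in> {1..Suc n}" and t: "\<tau> permutes {1..n}"
  shows "inversions (Suc n) (insert_value n k \<circ> \<tau>) = inversions n \<tau> + (Suc n - k)"
proof -
  let ?\<sigma> = "insert_value n k \<circ> \<tau>"
  let ?A = "{(i, j). i \<in> {1..n} \<and> j \<in> {1..n} \<and> i < j \<and> \<tau> i > \<tau> j}"
  let ?B = "{i \<in> {1..n}. \<tau> i \<ge> k}"
  have tn: "\<tau> i \<in> {1..n}" if "i \<in> {1..n}" for i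
    using t that by (simp only: permutes_in_image)
  have ts: "\<tau> (Suc n) = Suc n"
    using t by (auto intro: permutes_not_in)
  have *: "?\<sigma> i > ?\<sigma> j \<longleftrightarrow> \<tau> i > \<tau> j" if "i \<in> {1..n}" "j \<in> {1..n}" for i j
    using tn[OF that(1)] tn[OF that(2)] by (auto simp: insert_value_def)
  have **: "?\<sigma> i > ?\<sigma> (Suc n) \<longleftrightarrow> \<tau> i \<ge> k" if "i \<in> {1..n}" for i
    using tn[OF that] ts by (auto simp: insert_value_def)
  have "{(i, j). i \<in> {1..Suc n} \<and> j \<in> {1..Suc n} \<and> i < j \<and> ?\<sigma> i > ?\<sigma> j}
        = ?A \<union> (\<lambda>i. (i, Suc n)) ` ?B" (is "?L = ?R")
  proof (intro set_eqI, clarify)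
    fix i j
    show "(i, j) \<in> ?L \<longleftrightarrow> (i, j) \<in> ?R"
    proof (cases "j = Suc n")
      case True
      then show ?thesis using **[of i] by (auto simp del: comp_apply)
    next
      case False
      show ?thesis
      proof (cases "i \<in> {1..n} \<and> j \<in> {1..n}")
        case True
        then show ?thesis using *[of i j] False by (auto simp del: comp_apply)
      next
        case F: False
        then show ?thesis using False by (auto simp del: comp_apply)
      qed
    qed
  qed
  moreover have "card (?A \<union> (\<lambda>i. (i, Suc n)) ` ?B) = card ?A + card ((\<lambda>i. (i, Suc n)) ` ?B)"
  proof (rule card_Un_disjoint)
    show "finite ?A"
      by (rule finite_subset[of _ "{1..n} \<times> {1..n}"]) auto
  qed auto
  moreover have "card ((\<lambda>i. (i, Suc n)) ` ?B) = card ?B"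
    by (rule card_image) (auto simp: inj_on_def)
  moreover have "card ?B = card (\<tau> ` ?B)"
    using t by (metis card_image inj_on_subset permutes_inj subset_UNIV)
  moreover have "\<tau> ` ?B = {k..n}"
  proof (intro equalityI subsetI)
    fix x assume "x \<in> \<tau> ` ?B"
    then show "x \<in> {k..n}" using tn by fastforce
  next
    fix x assume x: "x \<in> {k..n}"
    with k have "x \<in> \<tau> ` {1..n}"
      by (simp only: permutes_image[OF t]) auto
    with x show "x \<in> \<tau> ` ?B" by auto
  qed
  ultimately show ?thesis
    by (simp add: inversions_def)
qed

lemma sum_inversions: "(\<Sum>\<sigma> | \<sigma> permutes {1..n}. q ^ inversions n \<sigma>) = mallows_Z n q"
proof (induction n)
  case 0
  have "{\<sigma>. \<sigma> permutes ({} :: nat set)} = {id}" by auto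
  then show ?case by (simp add: inversions_def mallows_Z_def)
next
  case (Suc n)
  have "(\<Sum>\<sigma> | \<sigma> permutes {1..Suc n}. q ^ inversions (Suc n) \<sigma>) =
        (\<Sum>(k, \<tau>) \<in> {1..Suc n} \<times> {\<tau>. \<tau> permutes {1..n}}.
           q ^ inversions (Suc n) (insert_value n k \<circ> \<tau>))"
    unfolding permutes_Suc_image
    by (subst sum.reindex[OF permutes_Suc_inj]) (simp add: case_prod_beta)
  also have "\<dots> = (\<Sum>(k, \<tau>) \<in> {1..Suc n} \<times> {\<tau>. \<tau> permutes {1..n}}.
           q ^ (Suc n - k) * q ^ inversions n \<tau>)"
    by (rule sum.cong) (auto simp del: atLeastAtMost_iff
          simp: inversions_insert_value power_add mult.commute)
  also have "\<dots> = (\<Sum>k=1..Suc n. q ^ (Suc n - k)) * mallows_Z n q"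
    by (simp only: Suc.IH[symmetric] sum_product sum.cartesian_product)
  also have "(\<Sum>k=1..Suc n. q ^ (Suc n - k)) = (\<Sum>j<Suc n. q ^ j)"
    by (rule sum.reindex_bij_witness[of _ "\<lambda>j. Suc n - j" "\<lambda>k. Suc n - k"]) auto
  finally show ?case
    by (simp add: mallows_Z_def mult.commute)
qed

lemma mallows_Z_pos: "q \<ge> 0 \<Longrightarrow> mallows_Z n q > 0"
  unfolding mallows_Z_def
proof (rule prod_pos)
  fix i assume q: "q \<ge> 0" and i: "i \<in> {1..n}"
  have "(0::real) < q ^ 0" by simp
  also have "\<dots> \<le> (\<Sum>j<i. q ^ j)"
    by (rule member_le_sum) (use q i in auto)
  finally show "(\<Sum>j<i. q ^ j) > 0" .
qed

lemma pmf_mallows: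
  assumes "q \<ge> 0"
  shows "pmf (mallows n q) \<sigma> =
           (if \<sigma> permutes {1..n} then q ^ inversions n \<sigma> / mallows_Z n q else 0)"
  unfolding mallows_def
proof (rule pmf_embed_pmf)
  let ?f = "\<lambda>\<sigma>. if \<sigma> permutes {1..n} then q ^ inversions n \<sigma> / mallows_Z n q else 0"
  show nn: "0 \<le> ?f x" for x
    using assms mallows_Z_pos[OF assms, of n] by auto
  have fin: "finite {\<sigma>. \<sigma> permutes {1..n}}" by (simp add: finite_permutations)
  have "(\<integral>\<^sup>+ x. ennreal (?f x) \<partial>count_space UNIV)
        = (\<Sum>x | x permutes {1..n}. ennreal (?f x))"
    by (rule nn_integral_count_space') (use fin in \<open>auto split: if_splits\<close>)
  also have "\<dots> = ennreal (\<Sum>x | x permutes {1..n}. ?f x)"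
    by (rule sum_ennreal) (rule nn)
  also have "(\<Sum>x | x permutes {1..n}. ?f x)
             = (\<Sum>x | x permutes {1..n}. q ^ inversions n x) / mallows_Z n q"
    unfolding sum_divide_distrib by (rule sum.cong) auto
  also have "\<dots> = 1"
    using mallows_Z_pos[OF assms, of n] by (simp only: sum_inversions) simp
  finally show "(\<integral>\<^sup>+ x. ennreal (?f x) \<partial>count_space UNIV) = 1" by simp
qed

lemma mallows_0: "mallows n 0 = return_pmf id"
proof -
  have "mallows_Z n 0 = 1"
    unfolding mallows_Z_def
  proof (rule prod.neutral, rule ballI)
    fix i assume "i \<in> {1..n}"
    then show "(\<Sum>j<i. (0::real) ^ j) = 1"
      by (cases i) (simp_all add: sum.lessThan_Suc_shift del: sum.lessThan_Suc)
  qed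
  moreover have "inversions n id = 0"
    unfolding inversions_def by (subst card_eq_0_iff) auto
  ultimately have "measure_pmf.prob (mallows n 0) {id} = 1"
    by (simp add: measure_pmf_single pmf_mallows permutes_id)
  then have "set_pmf (mallows n 0) \<subseteq> {id}"
    by (auto simp: measure_pmf.prob_eq_1 AE_measure_pmf_iff)
  then show ?thesis
    by (simp add: set_pmf_subset_singleton)
qed

end

theory Submission
  imports Defs
begin

text \<open>
  The theorem is a first-moment argument over the sets that could violate expansion. Suppose that
  \<open>S\<close> has \<open>s\<close> elements and fewer than \<open>c s\<close> neighbours in the tangled path. The tangled path
  contains the path \<open>1, 2, \<dots>, n\<close>, so \<open>S\<close> is a union of few intervals; it also contains
  the \<open>\<sigma>\<close>-image of that path, so the preimage \<open>T\<close> of \<open>S\<close> under \<open>\<sigma>\<close> is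
  a union of few intervals as well (lemma \<open>not_expander_imp_few_changes\<close>). Sets made of few
  intervals are rare: with \<open>x = n / s\<close>, their number is at most
  \<open>(exp \<delta> * (x / \<delta>) powr \<epsilon>) ^ s\<close>, where \<open>\<delta>\<close> and \<open>\<epsilon>\<close> are small
  (lemma \<open>card_few_changes_le_power\<close>).

  On the other hand, the Mallows measure maps a given \<open>T\<close> onto a given \<open>S\<close> with probability
  at most the inverse of the \<open>q\<close>-binomial coefficient \<open>Z\<^sub>n / (Z\<^sub>s Z\<^sub>n\<^sub>-\<^sub>s)\<close>. Indeed,
  forgetting the inversions between \<open>T\<close> and its complement, the weight of \<open>\<sigma>\<close> is at most
  the product of the weights of the two bijections \<open>T \<rightarrow> S\<close> and
  \<open>{1..n} - T \<rightarrow> {1..n} - S\<close>, and the sums of these weights are \<open>Z\<^sub>s\<close> and \<open>Z\<^sub>n\<^sub>-\<^sub>s\<close>.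
  The hypothesis on \<open>q\<close> gives \<open>q ^ n \<ge> 49/50\<close>, so the \<open>q\<close>-binomial coefficient loses at
  most a factor \<open>(49/50) ^ s\<close> against \<open>n choose s\<close> (lemma \<open>prob_mallows_image_le\<close>). This loss
  is exponential in \<open>s\<close> rather than in \<open>n\<close>, which is what allows small sets to be treated
  together with large ones.

  Since \<open>n choose s \<ge> x ^ s\<close> and \<open>x \<ge> 3/2\<close>, the expected number of bad pairs \<open>(S, T)\<close> of
  size \<open>s\<close> is at most \<open>g ^ s\<close> with \<open>g\<^sup>2 \<le> 5 / (4 x)\<close> and \<open>g \<le> 11/12\<close>. Spending
  two factors \<open>g\<close> on the gain \<open>s / n\<close> and the others on convergence shows that the sum over
  \<open>s \<ge> 2\<close> is \<open>O(1 / n)\<close> (lemmas \<open>few_changes_pairs_le\<close>, \<open>sum_arith_geometric_le\<close>).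
\<close>

section \<open>The Mallows weight of bijections between finite sets\<close>

definition inversions_on :: "nat set \<Rightarrow> (nat \<Rightarrow> nat) \<Rightarrow> nat" where
  "inversions_on A f = card {(i, j). i \<in> A \<and> j \<in> A \<and> i < j \<and> f i > f j}"

text \<open>
  Restricting to \<open>extensional A\<close> makes a bijection determined by its values on \<open>A\<close>, so that
  sums over this set count each bijection once.
\<close>

definition bijections :: "nat set \<Rightarrow> nat set \<Rightarrow> (nat \<Rightarrow> nat) set" where
  "bijections A B = {f \<in> extensional A. bij_betw f A B}"

lemma finite_bijections: "finite A \<Longrightarrow> finite B \<Longrightarrow> finite (bijections A B)"
  by (rule finite_subset[OF _ finite_PiE[of A "\<lambda>_. B"]])
     (auto simp: bijections_def PiE_def bij_betw_def)

lemma finite_inversion_pairs: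
  "finite A \<Longrightarrow> finite {(i, j). i \<in> A \<and> j \<in> A \<and> i < j \<and> (f i :: nat) > f (j :: nat)}"
  by (rule finite_subset[of _ "A \<times> A"]) auto

text \<open>
  The exponents are \<open>0, \<dots>, card B - 1\<close> in some order: they are the ranks in \<open>B\<close>, counted
  from the top.
\<close>

lemma sum_power_card_greater:
  fixes q :: real and B :: "nat set"
  assumes "finite B"
  shows "(\<Sum>k\<in>B. q ^ card {b \<in> B. k < b}) = (\<Sum>j<card B. q ^ j)"
  using assms
proof (induction B rule: finite_linorder_min_induct)
  case empty
  then show ?case by simp
next
  case (insert b B)
  have b: "b \<notin> B" using insert.hyps by auto
  have "{x \<in> insert b B. b < x} = B" using insert.hyps by auto
  moreover have "{x \<in> insert b B. k < x} = {x \<in> B. k < x}" if "k \<in> B" for k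
    using that insert.hyps by auto
  ultimately show ?case
    using insert b by (simp add: add.commute)
qed

text \<open>
  The last position \<open>a\<close> carries the value \<open>k\<close>, and it is inverted exactly with the positions
  of the larger values, all of which occur earlier.
\<close>

lemma inversions_on_insert_max:
  assumes A: "finite A" "\<forall>x\<in>A. x < a" and g: "bij_betw g A (B - {k})"
  shows "inversions_on (insert a A) (g(a := k)) = inversions_on A g + card {b \<in> B. k < b}"
proof -
  let ?f = "g(a := k)"
  have a: "a \<notin> A" using A by auto
  have "{(i, j). i \<in> insert a A \<and> j \<in> insert a A \<and> i < j \<and> ?f i > ?f j} =
     {(i, j). i \<in> A \<and> j \<in> A \<and> i < j \<and> g i > g j} \<union> (\<lambda>i. (i, a)) ` {i \<in> A. k < g i}"
    using A a by (auto split: if_splits dest: less_asym)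
  moreover have "card \<dots> = inversions_on A g + card ((\<lambda>i. (i, a)) ` {i \<in> A. k < g i})"
    unfolding inversions_on_def
    by (intro card_Un_disjoint) (use A a finite_inversion_pairs in auto)
  moreover have "card ((\<lambda>i. (i, a)) ` {i \<in> A. k < g i}) = card {i \<in> A. k < g i}"
    by (intro card_image) (auto simp: inj_on_def)
  moreover have "card {i \<in> A. k < g i} = card (g ` {i \<in> A. k < g i})"
    by (intro card_image[symmetric] inj_on_subset[OF bij_betw_imp_inj_on[OF g]]) auto
  moreover have "g ` {i \<in> A. k < g i} = {b \<in> g ` A. k < b}" by auto
  moreover have "\<dots> = {b \<in> B. k < b}"
    using g by (auto simp: bij_betw_def)
  ultimately show ?thesis by (simp add: inversions_on_def)
qed

text \<open>
  This is \<open>sum_inversions\<close> transported along the order isomorphisms of \<open>A\<close> and \<open>B\<close> with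
  initial segments. Induction over \<open>A\<close> from below avoids these isomorphisms: the image of the largest
  element of \<open>A\<close> is chosen freely in \<open>B\<close>, and it contributes a factor that does not depend on
  the rest of the bijection.
\<close>

lemma sum_inversions_bijections:
  fixes q :: real
  assumes "finite A" "finite B" "card A = card B"
  shows "(\<Sum>f\<in>bijections A B. q ^ inversions_on A f) = mallows_Z (card A) q"
  using assms
proof (induction A arbitrary: B rule: finite_linorder_max_induct)
  case empty
  then have "bijections {} B = {\<lambda>_. undefined}"
    by (auto simp: bijections_def bij_betw_def)
  then show ?case by (simp add: inversions_on_def mallows_Z_def)
next
  case (insert a A)
  have a: "a \<notin> A" using insert.hyps by auto
  have cB: "card B = Suc (card A)" using insert a by simp
  have "(\<Sum>f\<in>bijections (insert a A) B. q ^ inversions_on (insert a A) f) =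
        (\<Sum>(k, g)\<in>(SIGMA k:B. bijections A (B - {k})). q ^ inversions_on (insert a A) (g(a := k)))"
  proof (rule sum.reindex_bij_witness[of _ "\<lambda>(k, g). g(a := k)" "\<lambda>f. (f a, f(a := undefined))"])
    fix f assume f: "f \<in> bijections (insert a A) B"
    have f': "bij_betw f (insert a A) B" using f by (simp add: bijections_def)
    then have fa: "f a \<in> B" by (auto simp: bij_betw_def)
    with f' have "bij_betw f (insert a A - {a}) (B - {f a})" by (intro bij_betw_DiffI) auto
    then have "bij_betw f A (B - {f a})" using a by simp
    moreover have "f(a := undefined) \<in> extensional A"
      using f by (auto simp: bijections_def extensional_def)
    moreover have "bij_betw (f(a := undefined)) A (B - {f a}) \<longleftrightarrow> bij_betw f A (B - {f a})"
      using a by (intro bij_betw_cong) auto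
    ultimately show "(f a, f(a := undefined)) \<in> (SIGMA k:B. bijections A (B - {k}))"
      using fa by (simp add: bijections_def)
  next
    fix p assume p: "p \<in> (SIGMA k:B. bijections A (B - {k}))"
    obtain k g where kg: "p = (k, g)" by (cases p)
    have g: "k \<in> B" "g \<in> extensional A" "bij_betw g A (B - {k})" 
      using p kg by (auto simp: bijections_def)
    have "bij_betw (g(a := k)) A (B - {k}) \<longleftrightarrow> bij_betw g A (B - {k})"
      using a by (intro bij_betw_cong) auto
    with g have "bij_betw (g(a := k)) (A \<union> {a}) ((B - {k}) \<union> {k})"
      by (intro bij_betw_combine) (auto simp: bij_betw_def)
    moreover have "(B - {k}) \<union> {k} = B" using g by auto
    ultimately show "(case p of (k, g) \<Rightarrow> g(a := k)) \<in> bijections (insert a A) B"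
      using g kg by (auto simp: bijections_def extensional_def)
    show "((case p of (k, g) \<Rightarrow> g(a := k)) a, (case p of (k, g) \<Rightarrow> g(a := k))(a := undefined)) = p"
      using g kg a by (auto simp: extensional_def)
  qed auto
  also have "\<dots> = (\<Sum>k\<in>B. \<Sum>g\<in>bijections A (B - {k}). q ^ inversions_on (insert a A) (g(a := k)))"
    using insert finite_bijections by (subst sum.Sigma) auto
  also have "\<dots> = (\<Sum>k\<in>B. \<Sum>g\<in>bijections A (B - {k}). q ^ inversions_on A g * q ^ card {b \<in> B. k < b})"
    using insert.hyps 
    by (intro sum.cong refl) 
       (auto simp: inversions_on_insert_max bijections_def power_add simp del: fun_upd_apply)
  also have "\<dots> = (\<Sum>k\<in>B. mallows_Z (card A) q * q ^ card {b \<in> B. k < b})"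
  proof (intro sum.cong refl)
    fix k assume "k \<in> B"
    then have "(\<Sum>g\<in>bijections A (B - {k}). q ^ inversions_on A g) = mallows_Z (card A) q"
      using insert.prems cB by (intro insert.IH) auto
    then show "(\<Sum>g\<in>bijections A (B - {k}). q ^ inversions_on A g * q ^ card {b \<in> B. k < b}) =
       mallows_Z (card A) q * q ^ card {b \<in> B. k < b}"
      by (simp add: sum_distrib_right[symmetric])
  qed
  also have "\<dots> = mallows_Z (card A) q * (\<Sum>j<card B. q ^ j)"
    using insert.prems by (simp add: sum_distrib_left[symmetric] sum_power_card_greater)
  also have "\<dots> = mallows_Z (card (insert a A)) q"
    using a insert.hyps cB by (simp add: mallows_Z_def)
  finally show ?case .
qed

text \<open>
  The inequality discards the inversions between \<open>T\<close> and \<open>V - T\<close>.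
\<close>

lemma inversions_on_split:
  assumes "finite V" "T \<subseteq> V"
  shows "inversions_on T (restrict f T) + inversions_on (V - T) (restrict f (V - T)) \<le> inversions_on V f"
proof -
  have r: "inversions_on A (restrict f A) = inversions_on A f" for A
    unfolding inversions_on_def by (rule arg_cong[where f = card]) auto
  have "inversions_on T f + inversions_on (V - T) f =
     card ({(i, j). i \<in> T \<and> j \<in> T \<and> i < j \<and> f i > f j} \<union>
           {(i, j). i \<in> V - T \<and> j \<in> V - T \<and> i < j \<and> f i > f j})"
    unfolding inversions_on_def using assms
    by (intro card_Un_disjoint[symmetric] finite_inversion_pairs) (auto intro: finite_subset)
  also have "\<dots> \<le> inversions_on V f"
    unfolding inversions_on_def using assms
    by (intro card_mono finite_inversion_pairs) auto
  finally show ?thesis by (simp only: r)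
qed

section \<open>The probability of mapping one given set onto another\<close>

text \<open>
  A permutation that maps \<open>T\<close> onto \<open>S\<close> consists of a bijection \<open>T \<rightarrow> S\<close> and one
  between the complements. As \<open>q \<le> 1\<close>, \<open>inversions_on_split\<close> bounds its weight by the product of
  the two weights, and the sum over all pairs of bijections factorises.
\<close>

lemma sum_inversions_image_le:
  fixes q :: real
  assumes q: "0 \<le> q" "q \<le> 1" and T: "T \<subseteq> {1..n}" and S: "S \<subseteq> {1..n}" and c: "card T = card S"
  shows "(\<Sum>\<sigma> | \<sigma> permutes {1..n} \<and> \<sigma> ` T = S. q ^ inversions n \<sigma>)
    \<le> mallows_Z (card T) q * mallows_Z (n - card T) q"
proof -
  let ?V = "{1..n}" and ?P = "{\<sigma>. \<sigma> permutes {1..n} \<and> \<sigma> ` T = S}"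
  let ?h = "\<lambda>\<sigma>::nat \<Rightarrow> nat. (restrict \<sigma> T, restrict \<sigma> (?V - T))"
  let ?w = "\<lambda>(f, g). q ^ inversions_on T f * q ^ inversions_on (?V - T) g"
  have fin: "finite T" "finite S" "finite (?V - T)" "finite (?V - S)"
    using T S finite_subset[OF _ finite_atLeastAtMost] by auto
  have inj: "inj_on ?h ?P"
  proof (rule inj_onI)
    fix \<sigma> \<tau> assume s: "\<sigma> \<in> ?P" and t: "\<tau> \<in> ?P" and eq: "?h \<sigma> = ?h \<tau>"
    show "\<sigma> = \<tau>"
    proof
      fix x
      have "restrict \<sigma> T x = restrict \<tau> T x" "restrict \<sigma> (?V - T) x = restrict \<tau> (?V - T) x"
        using eq by auto
      moreover have "x \<notin> ?V \<Longrightarrow> \<sigma> x = \<tau> x"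
        using s t permutes_not_in by (metis mem_Collect_eq)
      ultimately show "\<sigma> x = \<tau> x"
        by (cases "x \<in> T"; cases "x \<in> ?V") (simp_all split: if_splits)
    qed
  qed
  have sub: "?h ` ?P \<subseteq> bijections T S \<times> bijections (?V - T) (?V - S)"
  proof clarify
    fix \<sigma> assume s: "\<sigma> permutes ?V"  and "S = \<sigma> ` T"
    moreover have "inj_on \<sigma> A" for A using s by (metis inj_on_subset permutes_inj subset_UNIV)
    moreover have "\<sigma> ` (?V - T) = \<sigma> ` ?V - \<sigma> ` T"
      using s T by (intro inj_on_image_set_diff[of _ ?V]) (auto intro: permutes_inj_on)
    ultimately show "restrict \<sigma> T \<in> bijections T (\<sigma> ` T) \<and>
         restrict \<sigma> (?V - T) \<in> bijections (?V - T) (?V - \<sigma> ` T)"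
      using permutes_image[OF s]
      by (auto simp: bijections_def bij_betw_def)
  qed
  have "(\<Sum>\<sigma>\<in>?P. q ^ inversions n \<sigma>) \<le> (\<Sum>\<sigma>\<in>?P. ?w (?h \<sigma>))"
  proof (rule sum_mono)
    fix \<sigma>
    have "q ^ inversions n \<sigma> \<le>
       q ^ (inversions_on T (restrict \<sigma> T) + inversions_on (?V - T) (restrict \<sigma> (?V - T)))"
      using inversions_on_split[of ?V T \<sigma>] T q
      by (intro power_decreasing) (auto simp: inversions_on_def inversions_def)
    then show "q ^ inversions n \<sigma> \<le> ?w (?h \<sigma>)" by (simp add: power_add)
  qed
  also have "\<dots> = sum ?w (?h ` ?P)"
    using inj by (simp add: sum.reindex)
  also have "\<dots> \<le> sum ?w (bijections T S \<times> bijections (?V - T) (?V - S))"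
    using q fin by (intro sum_mono2 sub finite_cartesian_product finite_bijections) auto
  also have "\<dots> = (\<Sum>f\<in>bijections T S. q ^ inversions_on T f) *
      (\<Sum>g\<in>bijections (?V - T) (?V - S). q ^ inversions_on (?V - T) g)"
    by (simp add: sum_product sum.cartesian_product)
  also have "\<dots> = mallows_Z (card T) q * mallows_Z (n - card T) q"
    using fin c T S 
    by (simp add: sum_inversions_bijections card_Diff_subset)
  finally show ?thesis .
qed

lemma mallows_Z_le_fact:
  assumes "0 \<le> q" "q \<le> 1"
  shows "mallows_Z n q \<le> fact n"
proof -
  have "(\<Sum>j<i. q ^ j) \<le> (\<Sum>j<i. 1)" for i
    using assms by (intro sum_mono power_le_one) auto
  then have "mallows_Z n q \<le> (\<Prod>i=1..n. real i)"
    unfolding mallows_Z_def using assms by (intro prod_mono) (auto intro!: sum_nonneg)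
  then show ?thesis by (simp add: fact_prod)
qed

text \<open>
  Each of the last \<open>s\<close> factors \<open>1 + q + \<dots> + q ^ m\<close> of the normalisation is at least
  \<open>(m + 1) a\<close>.
\<close>

lemma mallows_Z_ge:
  assumes q: "0 \<le> q" "q \<le> 1" and a: "0 \<le> a" "a \<le> q ^ n" and "s \<le> n"
  shows "mallows_Z (n - s) q * (a ^ s * fact n / fact (n - s)) \<le> mallows_Z n q"
  using \<open>s \<le> n\<close>
proof (induction s)
  case 0
  then show ?case by simp
next
  case (Suc s)
  define m where "m = n - Suc s"
  have m: "n - s = Suc m" "n - Suc s = m" using Suc.prems by (auto simp: m_def)
  have "real (Suc m) * a = (\<Sum>j<Suc m. a)" by simp
  also have "\<dots> \<le> (\<Sum>j<Suc m. q ^ j)"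
  proof (rule sum_mono)
    fix j assume "j \<in> {..<Suc m}"
    then have "q ^ n \<le> q ^ j" using q m Suc.prems by (intro power_decreasing) auto
    with a show "a \<le> q ^ j" by simp
  qed
  finally have le: "real (Suc m) * a \<le> (\<Sum>j<Suc m. q ^ j)" .
  have "mallows_Z m q * (a ^ Suc s * fact n / fact m) =
        mallows_Z m q * (real (Suc m) * a) * (a ^ s * fact n / fact (Suc m))"
    by (simp add: field_simps del: of_nat_Suc)
  also have "\<dots> \<le> mallows_Z m q * (\<Sum>j<Suc m. q ^ j) * (a ^ s * fact n / fact (Suc m))"
    using le a mallows_Z_pos[OF q(1), of m] 
    by (intro mult_right_mono mult_left_mono) auto
  also have "\<dots> = mallows_Z (Suc m) q * (a ^ s * fact n / fact (Suc m))"
    by (simp add: mallows_Z_def)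
  also have "\<dots> \<le> mallows_Z n q" using Suc by (simp add: m)
  finally show ?case by (simp add: m)
qed

text \<open>
  For \<open>q = 1\<close> one may take \<open>a = 1\<close>, and the bound is then the exact probability under the uniform
  measure.
\<close>

lemma prob_mallows_image_le:
  assumes q: "0 \<le> q" "q \<le> 1" and a: "0 < a" "a \<le> q ^ n"
    and T: "T \<subseteq> {1..n}" and S: "S \<subseteq> {1..n}" and c: "card T = s" "card S = s"
  shows "measure_pmf.prob (mallows n q) {\<sigma>. \<sigma> ` T = S} \<le> 1 / (a ^ s * real (n choose s))"
proof -
  let ?P = "{\<sigma>. \<sigma> permutes {1..n} \<and> \<sigma> ` T = S}"
  have sn: "s \<le> n" using card_mono[OF _ T] c by simp
  have fin: "finite ?P"
    by (rule finite_subset[OF _ finite_permutations[of "{1..n}"]]) auto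
  have "measure_pmf.prob (mallows n q) {\<sigma>. \<sigma> ` T = S} = measure_pmf.prob (mallows n q) ?P"
    by (rule measure_eq_AE) (auto simp: AE_measure_pmf_iff set_pmf_iff pmf_mallows[OF q(1)] split: if_splits)
  also have "\<dots> = (\<Sum>\<sigma>\<in>?P. q ^ inversions n \<sigma> / mallows_Z n q)"
    using fin by (simp add: measure_measure_pmf_finite pmf_mallows[OF q(1)])
  also have "\<dots> = (\<Sum>\<sigma>\<in>?P. q ^ inversions n \<sigma>) / mallows_Z n q"
    by (simp add: sum_divide_distrib)
  also have "\<dots> \<le> (fact s * mallows_Z (n - s) q) / mallows_Z n q"
    using sum_inversions_image_le[OF q T S] c mallows_Z_le_fact[OF q, of s] 
       mallows_Z_pos[OF q(1), of n] mallows_Z_pos[OF q(1), of "n - s"]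
    by (intro divide_right_mono) (auto intro: order_trans mult_right_mono)
  also have "\<dots> \<le> (fact s * mallows_Z (n - s) q) / (mallows_Z (n - s) q * (a ^ s * fact n / fact (n - s)))"
    using mallows_Z_ge[OF q _ a(2) sn] a mallows_Z_pos[OF q(1), of n] mallows_Z_pos[OF q(1), of "n - s"]
    by (intro divide_left_mono mult_pos_pos) auto
  also have "\<dots> = 1 / (a ^ s * real (n choose s))"
    using sn a mallows_Z_pos[OF q(1), of "n - s"]
    by (simp add: binomial_fact field_simps)
  finally show ?thesis .
qed

section \<open>Non-expanding sets consist of few intervals on both paths\<close>

definition path_edges :: "nat \<Rightarrow> nat set set" where
  "path_edges n = {{i, i + 1} | i. 1 \<le> i \<and> i < n}"

text \<open>
  The places where membership in \<open>S\<close> changes along \<open>0, 1, \<dots>, n\<close>. The element \<open>0\<close>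
  never belongs to \<open>S \<subseteq> {1..n}\<close> and serves as the starting value, so that \<open>S\<close> can be
  recovered from its changes.
\<close>

definition changes :: "nat \<Rightarrow> nat set \<Rightarrow> nat set" where
  "changes n S = {i. i < n \<and> (i \<in> S \<longleftrightarrow> i + 1 \<notin> S)}"

lemma inj_on_changes: "inj_on (changes n) (Pow {1..n})"
proof (rule inj_onI)
  fix S T assume S: "S \<in> Pow {1..n}" and T: "T \<in> Pow {1..n}" and eq: "changes n S = changes n T"
  have "i \<le> n \<Longrightarrow> i \<in> S \<longleftrightarrow> i \<in> T" for i
  proof (induction i)
    case 0
    then show ?case using S T by auto
  next
    case (Suc i)
    moreover have "i \<in> changes n S \<longleftrightarrow> i \<in> changes n T" using eq by simp
    ultimately show ?case by (auto simp: changes_def)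
  qed
  then show "S = T" using S T by (auto simp: subset_iff)
qed

text \<open>
  A change at \<open>i \<ge> 1\<close> makes \<open>i\<close> or \<open>i + 1\<close> a boundary vertex, and a vertex arises in
  this way at most twice; the change at \<open>0\<close> is the only one without a boundary vertex. This gives
  \<open>2 b + 1\<close> changes for \<open>b\<close> boundary vertices, and \<open>2 b + 1 \<le> 3 b\<close> because \<open>b > 0\<close>.
\<close>

lemma card_changes_le:
  assumes S: "S \<subseteq> {1..n}" "S \<noteq> {}" "S \<noteq> {1..n}"
  shows "vertex_boundary {1..n} (path_edges n) S \<noteq> {}"
    and "card (changes n S) \<le> 3 * card (vertex_boundary {1..n} (path_edges n) S)"
proof -
  let ?B = "vertex_boundary {1..n} (path_edges n) S"
  have n: "n \<ge> 1" using S by (cases n) auto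
  have finB: "finite ?B" by (simp add: vertex_boundary_def)
  have sub: "changes n S \<subseteq> {0} \<union> ?B \<union> (\<lambda>v. v - 1) ` ?B"
  proof
    fix i assume i: "i \<in> changes n S"
    show "i \<in> {0} \<union> ?B \<union> (\<lambda>v. v - 1) ` ?B"
    proof (cases "i = 0")
      case False
      then have e: "{i, i + 1} \<in> path_edges n"
        using i by (auto simp: path_edges_def changes_def)
      show ?thesis
      proof (cases "i \<in> S")
        case True
        with i e have "i + 1 \<in> ?B"
          by (auto simp: vertex_boundary_def changes_def insert_commute)
        then have "i + 1 - 1 \<in> (\<lambda>v. v - 1) ` ?B" by (rule imageI)
        then show ?thesis by simp
      next
        case F: False
        with i e False have "i \<in> ?B"
          by (auto simp: vertex_boundary_def changes_def insert_commute)
        then show ?thesis by simp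
      qed
    qed simp
  qed
  show ne: "?B \<noteq> {}"
  proof
    assume "?B = {}"
    \<comment> \<open>Only the trivial sets have no change beyond the one at \<open>0\<close>.\<close>
    with sub have "changes n S = {} \<or> changes n S = {0}" by auto
    moreover have "changes n {} = {}" "changes n {1..n} = {0}"
      using n by (auto simp: changes_def)
    ultimately have "changes n S = changes n {} \<or> changes n S = changes n {1..n}" by simp
    then have "S = {} \<or> S = {1..n}"
      using inj_on_changes[of n] S(1) by (auto dest: inj_onD)
    with S show False by simp
  qed
  have "card (changes n S) \<le> card ({0} \<union> ?B \<union> (\<lambda>v. v - 1) ` ?B)"
    using finB by (intro card_mono sub) auto
  also have "\<dots> \<le> card ({0} \<union> ?B) + card ((\<lambda>v. v - 1) ` ?B)" by (rule card_Un_le)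
  also have "\<dots> \<le> card {0::nat} + card ?B + card ?B"
    using finB by (intro add_mono card_Un_le card_image_le)
  also have "\<dots> \<le> 3 * card ?B"
    using ne finB by (simp add: Suc_le_eq card_gt_0_iff)
  finally show "card (changes n S) \<le> 3 * card ?B" .
qed

lemma vertex_boundary_path_subset:
  "vertex_boundary {1..n} (path_edges n) S \<subseteq> vertex_boundary {1..n} (tangled_edges n \<sigma>) S"
  by (auto simp: vertex_boundary_def path_edges_def tangled_edges_def)

lemma image_vertex_boundary_path_subset:
  assumes "\<sigma> permutes {1..n}"
  shows "\<sigma> ` vertex_boundary {1..n} (path_edges n) T
    \<subseteq> vertex_boundary {1..n} (tangled_edges n \<sigma>) (\<sigma> ` T)"
proof (rule image_subsetI)
  fix v assume "v \<in> vertex_boundary {1..n} (path_edges n) T"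
  then obtain u i where v: "v \<in> {1..n}" "v \<notin> T" "u \<in> T" "{u, v} = {i, i + 1}" "1 \<le> i" "i < n"
    by (auto simp: vertex_boundary_def path_edges_def)
  have "{\<sigma> u, \<sigma> v} = \<sigma> ` {u, v}" by simp
  also have "\<dots> = {\<sigma> i, \<sigma> (i + 1)}" unfolding v(4) by simp
  finally have "{\<sigma> u, \<sigma> v} \<in> tangled_edges n \<sigma>"
    using v by (auto simp: tangled_edges_def)
  moreover have "\<sigma> v \<in> {1..n}"
    using permutes_in_image[OF assms] v(1) by blast
  moreover have "\<sigma> v \<notin> \<sigma> ` T" 
    using permutes_inj[OF assms] v(2) by (simp add: inj_image_mem_iff)
  ultimately show "\<sigma> v \<in> vertex_boundary {1..n} (tangled_edges n \<sigma>) (\<sigma> ` T)"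
    using v(3) by (auto simp: vertex_boundary_def)
qed

text \<open>
  The threshold 400 matches expansion constant 1/1200: fewer than \<open>s / 1200\<close> boundary vertices
  mean fewer than \<open>3 s / 1200\<close> changes.
\<close>

definition few_changes :: "nat \<Rightarrow> nat \<Rightarrow> nat set set" where
  "few_changes n s = {S. S \<subseteq> {1..n} \<and> card S = s \<and> 400 * card (changes n S) \<le> s}"

lemma finite_few_changes: "finite (few_changes n s)"
  by (rule finite_subset[of _ "Pow {1..n}"]) (auto simp: few_changes_def)

text \<open>
  Both the path on \<open>{1..n}\<close> and its \<open>\<sigma>\<close>-image are subgraphs of the tangled path, so the path
  boundaries of \<open>S\<close> and of its preimage \<open>T\<close> are no larger than the boundary of \<open>S\<close> in the
  tangled path. The path boundary of \<open>S\<close> is non-empty, which excludes \<open>s < 2\<close>.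
\<close>

lemma not_expander_imp_few_changes:
  assumes \<sigma>: "\<sigma> permutes {1..n}" and n: "n \<ge> 3"
    and bad: "\<not> vertex_expander (1 / 1200) {1..n} (tangled_edges n \<sigma>)"
  shows "\<exists>s\<ge>2. 3 * s \<le> 2 * n \<and> (\<exists>S\<in>few_changes n s. \<exists>T\<in>few_changes n s. \<sigma> ` T = S)"
proof -
  let ?E = "tangled_edges n \<sigma>"
  obtain S where S: "S \<subseteq> {1..n}" "S \<noteq> {}" "int (card S) \<le> \<lceil>real n / 2\<rceil>"
    and "real (card (vertex_boundary {1..n} ?E S)) < 1 / 1200 * real (card S)"
    using bad unfolding vertex_expander_def by (auto simp: not_le simp del: One_nat_def)
  then have small: "1200 * card (vertex_boundary {1..n} ?E S) < card S" by linarith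
  define s where "s = card S"
  define T where "T = inv \<sigma> ` S"
  have sT: "\<sigma> ` T = S"
    unfolding T_def using permutes_surj[OF \<sigma>] by (rule image_f_inv_f)
  have injs: "inj_on \<sigma> A" for A using \<sigma> by (metis inj_on_subset permutes_inj subset_UNIV)
  have cT: "card T = s" using card_image[OF injs, of T] sT by (simp add: s_def)
  have TV: "T \<subseteq> {1..n}"
    unfolding T_def using permutes_image[OF permutes_inv[OF \<sigma>]] S(1) by blast
  have "real s < real n / 2 + 1"
    using S(3) unfolding s_def by linarith
  \<comment> \<open>The size limit allows \<open>s = (n + 1) / 2\<close> for odd \<open>n\<close>, hence the bound by \<open>2 n / 3\<close>.\<close>
  then have "2 * s < n + 2" by linarith
  then have s: "3 * s \<le> 2 * n" using n by linarith
  with n have "s < n" by linarith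
  then have ne: "S \<noteq> {1..n}" "T \<noteq> {1..n}" using cT by (auto simp: s_def)
  have neT: "T \<noteq> {}" using S(2) sT by auto
  have fin: "finite (vertex_boundary {1..n} ?E S)" by (simp add: vertex_boundary_def)
  have bS: "card (vertex_boundary {1..n} (path_edges n) S) \<le> card (vertex_boundary {1..n} ?E S)"
    using fin by (intro card_mono vertex_boundary_path_subset)
  have "card (vertex_boundary {1..n} (path_edges n) T)
      = card (\<sigma> ` vertex_boundary {1..n} (path_edges n) T)"
    by (rule card_image[symmetric, OF injs])
  also have "\<dots> \<le> card (vertex_boundary {1..n} ?E S)"
    using fin image_vertex_boundary_path_subset[OF \<sigma>, of T] by (intro card_mono) (auto simp: sT)
  finally have bT: "card (vertex_boundary {1..n} (path_edges n) T) \<le> card (vertex_boundary {1..n} ?E S)" .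
  have "S \<in> few_changes n s" "T \<in> few_changes n s"
    using card_changes_le(2)[OF S(1,2) ne(1)] card_changes_le(2)[OF TV neT ne(2)] bS bT small S(1) TV cT
    by (auto simp: few_changes_def s_def)
  moreover have "card (vertex_boundary {1..n} (path_edges n) S) > 0"
    using card_changes_le(1)[OF S(1,2) ne(1)] by (simp add: card_gt_0_iff vertex_boundary_def)
  then have "s \<ge> 2" using bS small by (simp add: s_def)
  ultimately show ?thesis using s sT by blast
qed

section \<open>Counting sets with few changes\<close>

text \<open>
  Chernoff's method: give a subset \<open>D\<close> the weight \<open>t ^ card D\<close>. The small subsets have weight at
  least \<open>t ^ m\<close>, and by the binomial theorem all subsets together have weight \<open>(1 + t) ^ card A\<close>.
\<close>

lemma card_small_subsets_le:
  fixes t :: real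
  assumes A: "finite A" and t: "0 < t" "t \<le> 1"
  shows "real (card {D. D \<subseteq> A \<and> card D \<le> m}) \<le> (1 + t) ^ card A / t ^ m"
proof -
  have "real (card {D. D \<subseteq> A \<and> card D \<le> m}) * t ^ m = (\<Sum>D | D \<subseteq> A \<and> card D \<le> m. t ^ m)"
    by simp
  also have "\<dots> \<le> (\<Sum>D | D \<subseteq> A \<and> card D \<le> m. t ^ card D)"
    using t by (intro sum_mono power_decreasing) auto
  also have "\<dots> \<le> (\<Sum>D\<in>Pow A. t ^ card D)"
    using A t by (intro sum_mono2) auto
  also have "\<dots> = (1 + t) ^ card A"
    using prod_add[OF A, of "\<lambda>_. t" "\<lambda>_. 1"] by (simp add: add.commute)
  finally show ?thesis using t by (simp add: pos_le_divide_eq)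
qed

lemma card_few_changes_le:
  assumes t: "0 < t" "t \<le> 1"
  shows "real (card (few_changes n s)) \<le> (1 + t) ^ n / t ^ (s div 400)"
proof -
  have "card (few_changes n s) = card (changes n ` few_changes n s)"
    by (intro card_image[symmetric] inj_on_subset[OF inj_on_changes]) (auto simp: few_changes_def)
  also have "\<dots> \<le> card {D. D \<subseteq> {..<n} \<and> card D \<le> s div 400}"
    by (intro card_mono) (auto simp: few_changes_def changes_def)
  also have "real \<dots> \<le> (1 + t) ^ n / t ^ (s div 400)"
    using card_small_subsets_le[OF _ t, of "{..<n}"] by simp
  finally show ?thesis by simp
qed

text \<open>
  The choice \<open>t = s / (32 n)\<close> in \<open>card_few_changes_le\<close> makes both factors exponential in
  \<open>s\<close>: \<open>(1 + t) ^ n \<le> exp (s / 32)\<close>, while \<open>1 / t = 32 n / s\<close> is raised to a power of at most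
  \<open>s / 400\<close>.
\<close>

lemma card_few_changes_le_power:
  assumes s: "0 < s" "s \<le> n"
  shows "real (card (few_changes n s))
    \<le> (exp (1 / 32) * (32 * (real n / real s)) powr (1 / 400)) ^ s"
proof -
  define y where "y = 32 * (real n / real s)"
  have y: "y \<ge> 32" using s by (simp add: y_def field_simps)
  have "real (card (few_changes n s)) \<le> (1 + 1 / y) ^ n / (1 / y) ^ (s div 400)"
    using y by (intro card_few_changes_le) auto
  also have "\<dots> = (1 + 1 / y) ^ n * y ^ (s div 400)"
    by (simp add: power_divide)
  also have "\<dots> \<le> exp (1 / y) ^ n * (y powr (1 / 400)) ^ s"
  proof (intro mult_mono power_mono exp_ge_add_one_self)
    have "y ^ (s div 400) = y powr real (s div 400)" using y by (simp add: powr_realpow)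
    also have "\<dots> \<le> y powr (real s / 400)"
      using y of_nat_div_le_of_nat[of s 400, where 'a = real] by (intro powr_mono) auto
    also have "\<dots> = (y powr (1 / 400)) ^ s"
      using y by (simp add: powr_realpow[symmetric] powr_powr)
    finally show "y ^ (s div 400) \<le> (y powr (1 / 400)) ^ s" .
  qed (use y in auto)
  also have "exp (1 / y) ^ n = exp (1 / 32) ^ s"
    using s by (simp add: exp_of_nat_mult[symmetric] y_def)
  finally show ?thesis by (simp add: y_def power_mult_distrib)
qed

section \<open>The union bound\<close>

text \<open>
  With \<open>x = n / s\<close>, the left-hand side is at most \<open>g ^ s\<close>, where \<open>g\<close> is of order
  \<open>x powr (1/200 - 1)\<close>. Its square is then below \<open>5 / (4 x)\<close>, which is at most \<open>5/6\<close> and hence at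
  most \<open>(11/12)\<^sup>2\<close>. Two of the \<open>s\<close> factors \<open>g\<close> are estimated by \<open>5 / (4 x)\<close> and the
  others by \<open>11/12\<close>.
\<close>

lemma few_changes_pairs_le:
  assumes s: "2 \<le> s" "3 * s \<le> 2 * n"
  shows "(real (card (few_changes n s)))\<^sup>2 / ((49 / 50) ^ s * real (n choose s))
    \<le> 5 / 4 * (real s / real n) * (11 / 12) ^ (s - 2)"
proof -
  define x where "x = real n / real s"
  define u where "u = exp (1 / 32) * (32 * x) powr (1 / 400)"
  define g where "g = u\<^sup>2 * (50 / 49) / x"
  have sn: "s \<le> n" "0 < s" using s by linarith+
  have x: "x \<ge> 3 / 2" using s sn by (simp add: x_def field_simps)
  have g0: "g \<ge> 0" using x by (simp add: g_def)
  have "(real (card (few_changes n s)))\<^sup>2 / ((49 / 50) ^ s * real (n choose s))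
     \<le> (u ^ s)\<^sup>2 / ((49 / 50) ^ s * x ^ s)"
    using card_few_changes_le_power[OF sn(2,1)] binomial_ge_n_over_k_pow_k[OF sn(1), where 'a=real] x sn
    by (intro frac_le power_mono mult_left_mono) (auto simp: u_def x_def)
  also have "\<dots> = g ^ s"
    by (simp add: g_def power_mult_distrib power_divide power_mult[symmetric] mult.commute)
  finally have le: "(real (card (few_changes n s)))\<^sup>2 / ((49 / 50) ^ s * real (n choose s)) \<le> g ^ s" .
  have e: "exp (1 / 8 :: real) \<le> 73 / 64"
    using exp_bound[of "1 / 8"] by (simp add: power2_eq_square)
  have y: "(21 / 20 * x) powr real 100 = (21 / 20 * x) ^ 100"
    using x by (intro powr_realpow) auto
  \<comment> \<open>Since \<open>x powr (1/100) \<le> x\<close>, it remains to see that \<open>32 \<le> (21/20) ^ 100\<close>.\<close>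
  have "1 + real 20 * (1 / 20) \<le> (1 + 1 / 20 :: real) ^ 20"
    by (rule Bernoulli_inequality) simp
  then have "2 ^ 5 \<le> ((21 / 20 :: real) ^ 20) ^ 5" by (intro power_mono) auto
  then have "(32 :: real) \<le> (21 / 20) ^ 100" by (simp flip: power_mult)
  then have "(32 * x) powr (1 / 100) \<le> ((21 / 20) ^ 100 * x ^ 100) powr (1 / 100)"
    using x by (intro powr_mono2 mult_mono self_le_power) auto
  also have "\<dots> = ((21 / 20 * x) powr real 100) powr (1 / 100)"
    unfolding y power_mult_distrib ..
  also have "\<dots> = 21 / 20 * x"
    using x by (subst powr_powr) simp
  finally have p: "(32 * x) powr (1 / 100) \<le> 21 / 20 * x" .
  have "u ^ 4 = exp (1 / 8) * (32 * x) powr (1 / 100)"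
    using x by (simp add: u_def power_mult_distrib exp_of_nat_mult[symmetric] 
       powr_realpow[symmetric] powr_powr)
  also have "\<dots> \<le> 73 / 64 * (21 / 20 * x)"
    using e p by (intro mult_mono) auto
  finally have u4: "u ^ 4 \<le> 73 / 64 * (21 / 20 * x)" .
  have "g\<^sup>2 = u ^ 4 * (50 / 49)\<^sup>2 / x\<^sup>2"
    by (simp add: g_def power_mult_distrib power_divide power_mult[symmetric])
  also have "\<dots> \<le> 73 / 64 * (21 / 20 * x) * (50 / 49)\<^sup>2 / x\<^sup>2"
    using u4 by (intro divide_right_mono mult_right_mono) auto
  also have "\<dots> \<le> 5 / 4 * (1 / x)"
    using x by (simp add: power2_eq_square field_simps)
  finally have g2: "g\<^sup>2 \<le> 5 / 4 * (1 / x)" .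
  also have "\<dots> \<le> (11 / 12)\<^sup>2" using x by (simp add: power2_eq_square field_simps)
  finally have gr: "g \<le> 11 / 12" by (rule power2_le_imp_le) simp
  have "g ^ s = g\<^sup>2 * g ^ (s - 2)"
    by (simp only: power_add[symmetric] le_add_diff_inverse[OF s(1)])
  also have "\<dots> \<le> 5 / 4 * (1 / x) * (11 / 12) ^ (s - 2)"
    using g2 gr g0 x by (intro mult_mono power_mono) auto
  finally show ?thesis using le by (simp add: x_def)
qed

text \<open>
  As \<open>j + 2 \<le> 2 (j + 1)\<close>, the sum is controlled by the derivative of the geometric series at
  \<open>11/12\<close>, which is 144; and \<open>5/4 * 2 * 144 = 360\<close>.
\<close>

lemma sum_arith_geometric_le:
  "(\<Sum>s\<in>{2..n}. 5 / 4 * (real s / real n) * (11 / 12) ^ (s - 2)) \<le> 360 / real n"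
proof -
  have sums: "(\<lambda>j. real (Suc j) * (11 / 12) ^ j) sums (1 / (1 - 11 / 12)\<^sup>2)"
    using geometric_deriv_sums[of "11 / 12 :: real"] by simp
  have "(\<Sum>s\<in>{2..n}. real s * (11 / 12) ^ (s - 2)) \<le> (\<Sum>j<n. 2 * (real (Suc j) * (11 / 12) ^ j))"
  proof (rule sum_le_included[where i = "\<lambda>j. j + 2"])
    show "\<forall>s\<in>{2..n}. \<exists>j\<in>{..<n}. j + 2 = s \<and>
        real s * (11 / 12) ^ (s - 2) \<le> 2 * (real (Suc j) * (11 / 12) ^ j)"
    proof
      fix s assume s: "s \<in> {2..n}"
      then have "real s * (11 / 12) ^ (s - 2) \<le> (2 * real (Suc (s - 2))) * (11 / 12) ^ (s - 2)"
        by (intro mult_right_mono) auto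
      with s show "\<exists>j\<in>{..<n}. j + 2 = s \<and>
          real s * (11 / 12) ^ (s - 2) \<le> 2 * (real (Suc j) * (11 / 12) ^ j)"
        by (intro bexI[of _ "s - 2"]) auto
    qed
  qed auto
  also have "\<dots> = 2 * (\<Sum>j<n. real (Suc j) * (11 / 12) ^ j)"
    by (simp only: sum_distrib_left)
  also have "(\<Sum>j<n. real (Suc j) * (11 / 12) ^ j) \<le> (\<Sum>j. real (Suc j) * (11 / 12) ^ j)"
    by (rule sum_le_suminf[OF sums_summable[OF sums]]) auto
  also have "\<dots> = 1 / (1 - 11 / 12)\<^sup>2" using sums by (rule sums_unique[symmetric])
  finally have "(\<Sum>s\<in>{2..n}. real s * (11 / 12) ^ (s - 2)) \<le> 288"
    by (simp add: power2_eq_square)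
  then have "(\<Sum>s\<in>{2..n}. real s * (11 / 12) ^ (s - 2)) * (5 / (4 * real n)) \<le> 288 * (5 / (4 * real n))"
    by (rule mult_right_mono) simp
  moreover have "(\<Sum>s\<in>{2..n}. 5 / 4 * (real s / real n) * (11 / 12) ^ (s - 2)) =
      (\<Sum>s\<in>{2..n}. real s * (11 / 12) ^ (s - 2)) * (5 / (4 * real n))"
    unfolding sum_distrib_right by (intro sum.cong) simp_all
  ultimately show ?thesis by simp
qed

text \<open>
  The hypothesis on \<open>q\<close> enters through Bernoulli's inequality, which gives \<open>q ^ n \<ge> 49/50\<close>. The
  union bound runs over all triples of a size \<open>s\<close>, a set \<open>S\<close> and a preimage \<open>T\<close>.
\<close>

lemma prob_not_expander_le:
  assumes q: "0 \<le> q" "q \<le> 1" "q \<ge> 1 - 1 / (50 * real n)" and n: "n \<ge> 3"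
  shows "measure_pmf.prob (tangled_path n q) {E. \<not> vertex_expander (1 / 1200) {1..n} E} \<le> 360 / real n"
proof -
  let ?M = "mallows n q"
  let ?I = "{s \<in> {2..n}. 3 * s \<le> 2 * n}"
  let ?F = "few_changes n"
  let ?J = "SIGMA s:?I. ?F s \<times> ?F s"
  let ?bad = "{\<sigma>. \<not> vertex_expander (1 / 1200) {1..n} (tangled_edges n \<sigma>)}"
  let ?U = "\<Union>(s, S, T)\<in>?J. {\<sigma>. \<sigma> ` T = S}"
  have small: "1 / (50 * real n) \<le> 1" using n by simp
  then have "1 + real n * (- (1 / (50 * real n))) \<le> (1 + - (1 / (50 * real n))) ^ n"
    by (intro Bernoulli_inequality) simp
  also have "\<dots> \<le> q ^ n"
    using q(3) small by (intro power_mono) linarith+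
  finally have qn: "49 / 50 \<le> q ^ n" using n by simp
  have "measure_pmf.prob (tangled_path n q) {E. \<not> vertex_expander (1 / 1200) {1..n} E} =
      measure_pmf.prob ?M ?bad"
    by (simp add: tangled_path_def vimage_def)
  also have "\<dots> \<le> measure_pmf.prob ?M ?U"
  proof (rule measure_pmf.finite_measure_mono_AE)
    show "AE \<sigma> in measure_pmf ?M. \<sigma> \<in> ?bad \<longrightarrow> \<sigma> \<in> ?U"
    proof (rule AE_pmfI, rule impI)
      fix \<sigma> assume "\<sigma> \<in> set_pmf ?M" and bad: "\<sigma> \<in> ?bad"
      then have "\<sigma> permutes {1..n}"
        by (auto simp: set_pmf_iff pmf_mallows[OF q(1)] split: if_splits)
      from not_expander_imp_few_changes[OF this n] bad
      obtain s S T where *: "2 \<le> s" "3 * s \<le> 2 * n" "S \<in> ?F s" "T \<in> ?F s" "\<sigma> ` T = S"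
        by auto
      then have "(s, S, T) \<in> ?J" by auto
      then show "\<sigma> \<in> ?U" using *(5) by blast
    qed
  qed simp
  also have "\<dots> \<le> (\<Sum>(s, S, T)\<in>?J. measure_pmf.prob ?M {\<sigma>. \<sigma> ` T = S})"
    unfolding case_prod_beta
    by (rule measure_UNION_le) (auto intro!: finite_SigmaI finite_few_changes)
  also have "\<dots> \<le> (\<Sum>(s, S, T)\<in>?J. 1 / ((49 / 50) ^ s * real (n choose s)))"
    using qn by (intro sum_mono) (auto intro!: prob_mallows_image_le q simp: few_changes_def)
  also have "\<dots> = (\<Sum>s\<in>?I. (real (card (?F s)))\<^sup>2 / ((49 / 50) ^ s * real (n choose s)))"
    by (subst sum.Sigma[symmetric])
       (auto intro: finite_few_changes simp: case_prod_beta card_cartesian_product power2_eq_square)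
  also have "\<dots> \<le> (\<Sum>s\<in>?I. 5 / 4 * (real s / real n) * (11 / 12) ^ (s - 2))"
    by (intro sum_mono few_changes_pairs_le) auto
  also have "\<dots> \<le> (\<Sum>s\<in>{2..n}. 5 / 4 * (real s / real n) * (11 / 12) ^ (s - 2))"
    by (intro sum_mono2) auto
  also have "\<dots> \<le> 360 / real n" by (rule sum_arith_geometric_le)
  finally show ?thesis .
qed

theorem theorem1p1:
  fixes q :: "nat \<Rightarrow> real"
  assumes "\<And>n. n \<ge> 1 \<Longrightarrow> q n \<in> {0..1}"
    and "\<And>n. n \<ge> 1 \<Longrightarrow> q n \<ge> 1 - 1 / (50 * real n)"
  shows "\<exists>c>0. (\<lambda>n. measure_pmf.prob (tangled_path n (q n))
                       {E. vertex_expander c {1..n} E}) \<longlonglongrightarrow> 1"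
proof (intro exI[of _ "1 / 1200"] conjI)
  let ?p = "\<lambda>n. measure_pmf.prob (tangled_path n (q n)) {E. vertex_expander (1 / 1200) {1..n} E}"
  show "?p \<longlonglongrightarrow> 1"
  proof (rule tendsto_sandwich)
    show "\<forall>\<^sub>F n in sequentially. 1 - 360 / real n \<le> ?p n"
      using eventually_ge_at_top[of 3]
    proof eventually_elim
      case (elim n)
      have "{E. \<not> vertex_expander (1 / 1200) {1..n} E} = UNIV - {E. vertex_expander (1 / 1200) {1..n} E}"
        by auto
      then have "measure_pmf.prob (tangled_path n (q n)) {E. \<not> vertex_expander (1 / 1200) {1..n} E} = 1 - ?p n"
        using measure_pmf.prob_compl[of "{E. vertex_expander (1 / 1200) {1..n} E}" "tangled_path n (q n)"] 
        by simp
      moreover have "measure_pmf.prob (tangled_path n (q n)) {E. \<not> vertex_expander (1 / 1200) {1..n} E} \<le> 360 / real n"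
        using assms[of n] elim by (intro prob_not_expander_le) auto
      ultimately show ?case by simp
    qed
    show "\<forall>\<^sub>F n in sequentially. ?p n \<le> 1" by simp
    have "(\<lambda>n. 1 - 360 / real n) \<longlonglongrightarrow> 1 - 0"
      by (intro tendsto_intros lim_const_over_n)
    then show "(\<lambda>n. 1 - 360 / real n) \<longlonglongrightarrow> 1" by simp
  qed simp
qed simp

end
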